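(* Let $q\ge0$, $t\ge1$ be integers. The zeta function of the cyclic language $\mathcal{L}(q,t)$ is $$\zeta(\mathcal{L}(q,t),T)=\frac{(1-qT)(1-T)}{1-(1+q+\mathcal{W}_1)T+qT^2},$$ where $\mathcal{W}_1$ is the number of words of length $1$ in $\mathcal{L}(q,t)$.
   Context: Consider the automaton $M_G$ over the alphabet $\{0,1,\dots,q+t\}$ with states $A,B,C$ and transitions: from $A$ or from $B$, a letter in $\{1+q,\dots,q+t\}$ leads to $A$, a letter in $\{1,\dots,q\}$ leads to $B$, and the letter $0$ leads to $C$; from $C$, a letter in $\{1+q,\dots,q+t\}$ leads to $A$, the letter $q$ leads to $C$, and all other letters are rejected. $\mathcal{L}(q,t)$ is the set of words $\omega$ for which there is a state $s\in\{A,B,C\}$ such that reading $\omega$ starting from $s$ accepts every letter, ends in state $s$, and passes through state $A$ at some point. For a language $L$ in which $\mathcal{W}_k$ denotes the number of words of length $k$, its zeta function is the formal power series $\zeta(L,T)=\exp\big(\sum_{k\ge1}\mathcal{W}_k T^k/k\big)$. *)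

theory Defs
  imports "HOL-Computational_Algebra.Formal_Power_Series"
begin

datatype state = State_A | State_B | State_C

text \<open>The value None means that the letter is rejected.\<close>

definition step :: "nat \<Rightarrow> nat \<Rightarrow> state \<Rightarrow> nat \<Rightarrow> state option" where
  "step q t s a =
     (if s = State_A \<or> s = State_B then
        (if a \<in> {1 + q..q + t} then Some State_A
         else if a \<in> {1..q} then Some State_B
         else if a = 0 then Some State_C
         else None)
      else
        (if a \<in> {1 + q..q + t} then Some State_A
         else if a = q then Some State_C
         else None))"

text \<open>The list of all states visited while reading a word, including the initial and the
  final one; None if some letter is rejected.\<close>

fun run :: "nat \<Rightarrow> nat \<Rightarrow> state \<Rightarrow> nat list \<Rightarrow> state list option" where
  "run q t s [] = Some [s]"
| "run q t s (a # w) =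
     (case step q t s a of
        None \<Rightarrow> None
      | Some s' \<Rightarrow> map_option (\<lambda>p. s # p) (run q t s' w))"

definition lang :: "nat \<Rightarrow> nat \<Rightarrow> nat list set" where
  "lang q t =
     {w \<in> lists {0..q + t}.
        \<exists>s p. run q t s w = Some p \<and> last p = s \<and> State_A \<in> set p}"

definition word_count :: "'a list set \<Rightarrow> nat \<Rightarrow> nat" where
  "word_count L k = card {w \<in> L. length w = k}"

definition zeta :: "'a list set \<Rightarrow> rat fps" where
  "zeta L = fps_compose (fps_exp 1)
     (Abs_fps (\<lambda>k. if k = 0 then 0 else of_nat (word_count L k) / of_nat k))"

end

theory Submission
  imports Defs
begin

text \<open>A letter above q resets the automaton to state A, so a nonempty word of the language is the
  label of exactly one closed walk through A. The number of words of length k is therefore the number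
  of all closed walks minus that of the closed walks avoiding A, i.e. the difference of the traces of
  the k-th powers of the transition matrix M and of its restriction M' to the states B and C. Hence
  the zeta function is the quotient of det (1 - T M') = (1 - q T) (1 - T) by
  det (1 - T M) = 1 - (1 + q + t) T + q T^2.\<close>

text \<open>The assumption \<open>log_deriv\<close> is F' = N'/N - D'/D with denominators cleared,
  so \<open>F\<close> plays the role of log (N / D). Since Z = exp F satisfies Z' = Z F', the series
  Z D / N has derivative zero, and its constant term is 1.\<close>

lemma fps_exp_compose_eq_divide:
  fixes F N D :: "'a::field_char_0 fps"
  assumes F0: "fps_nth F 0 = 0" and N0: "fps_nth N 0 = 1" and D0: "fps_nth D 0 = 1"
    and log_deriv: "fps_deriv F * N * D = fps_deriv N * D - fps_deriv D * N"
  shows "fps_compose (fps_exp 1) F = N / D"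
proof -
  define Z where "Z = fps_compose (fps_exp 1) F"
  have Z': "fps_deriv Z = Z * fps_deriv F"
    unfolding Z_def using F0 by (simp add: fps_compose_deriv)
  have Z0: "fps_nth Z 0 = 1"
    unfolding Z_def by simp
  have N: "inverse N * N = 1" and D: "inverse D * D = 1"
    using N0 D0 by (simp_all add: inverse_mult_eq_1)
  define Y where "Y = Z * D * inverse N"
  \<comment> \<open>With \<open>inverse N\<close> treated as an independent symbol this is a ring
    identity; the second summand is a correction that vanishes once \<open>inverse N * N = 1\<close>
    is used.\<close>
  have "fps_deriv Y = inverse N ^ 2 * Z * (fps_deriv F * N * D + fps_deriv D * N - fps_deriv N * D)
      + (Z * fps_deriv F * D + Z * fps_deriv D) * inverse N * (1 - inverse N * N)"
    using N0 unfolding Y_def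
    by (simp add: Z' fps_inverse_deriv) (simp add: algebra_simps power2_eq_square)
  also have "\<dots> = 0"
    by (simp add: log_deriv N)
  finally have "Y = fps_const (fps_nth Y 0)"
    by (simp only: fps_deriv_eq_0_iff)
  then have Y: "Y = 1"
    by (simp add: Y_def Z0 N0 D0)
  have "N / D = N * inverse D"
    using D0 by (simp add: fps_divide_unit)
  also have "\<dots> = Y * N * inverse D"
    by (simp add: Y)
  also have "\<dots> = Z * (inverse N * N) * (inverse D * D)"
    by (simp add: Y_def ac_simps)
  finally show ?thesis
    by (simp add: N D Z_def)
qed

lemma UNIV_state: "(UNIV :: state set) = {State_A, State_B, State_C}"
  using state.exhaust by auto

lemma run_SomeD: "run q t s w = Some p \<Longrightarrow> \<exists>p'. p = s # p' \<and> length p' = length w"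
  by (induction w arbitrary: s p) (fastforce split: option.splits)+

lemma step_eq_State_A_iff: "step q t s a = Some State_A \<longleftrightarrow> a \<in> {1 + q..q + t}"
  by (auto simp: step_def)

text \<open>A letter leads to A either from every state or from none, so the first visit to A after
  the start merges the two runs, and determinism keeps them together. The tail is taken because
  merely starting in A synchronizes nothing.\<close>

lemma run_synchronized:
  assumes "run q t s w = Some p" "run q t s' w = Some p'" "State_A \<in> set (tl p)"
  shows "last p = last p'"
  using assms
proof (induction w arbitrary: s s' p p')
  case Nil
  then show ?case by auto
next
  case (Cons a w)
  from Cons.prems(1) obtain s1 p1 where 1: "step q t s a = Some s1" "run q t s1 w = Some p1" "p = s # p1"
    by (auto split: option.splits)
  from Cons.prems(2) obtain s2 p2 where 2: "step q t s' a = Some s2" "run q t s2 w = Some p2" "p' = s' # p2"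
    by (auto split: option.splits)
  obtain r1 r2 where r: "p1 = s1 # r1" "p2 = s2 # r2"
    using run_SomeD[OF 1(2)] run_SomeD[OF 2(2)] by blast
  show ?case
  proof (cases "s1 = s2")
    case True
    then show ?thesis using 1 2 r by simp
  next
    case False
    then have "s1 \<noteq> State_A"
      using 1(1) 2(1) by (metis option.inject step_eq_State_A_iff)
    then have "State_A \<in> set (tl p1)"
      using Cons.prems(3) 1 r by auto
    from Cons.IH[OF 1(2) 2(2) this] show ?thesis
      using 1 2 r by simp
  qed
qed

lemma closed_run_unique:
  assumes p: "run q t s w = Some p" "last p = s" "State_A \<in> set p"
    and p': "run q t s' w = Some p'" "last p' = s'" "State_A \<in> set p'"
  shows "s = s'"
proof (cases "w = []")
  case True
  then show ?thesis using assms by auto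
next
  case False
  obtain r where r: "p = s # r" "length r = length w"
    using run_SomeD[OF p(1)] by blast
  have "r \<noteq> []"
    using r(2) False by force
  \<comment> \<open>If A is visited only as the starting state, closedness still helps: the start
    recurs as the last state, which lies in the tail.\<close>
  then have "last p \<in> set (tl p)"
    by (simp add: r(1))
  then have "State_A \<in> set (tl p)"
    using p(2,3) by (cases "s = State_A") (simp_all add: r(1))
  with run_synchronized[OF p(1) p'(1)] p p' show ?thesis by simp
qed

definition path_words :: "nat \<Rightarrow> nat \<Rightarrow> state set \<Rightarrow> state \<Rightarrow> state \<Rightarrow> nat \<Rightarrow> nat list set" where
  "path_words q t S s f k = {w \<in> lists {0..q + t}. length w = k \<and>
     (\<exists>p. run q t s w = Some p \<and> last p = f \<and> set p \<subseteq> S)}"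

lemma finite_path_words [simp]: "finite (path_words q t S s f k)"
  by (rule finite_subset[OF _ finite_lists_length_eq[of "{0..q + t}" k]])
     (auto simp: path_words_def in_lists_conv_set)

lemma path_words_0: "path_words q t S s f 0 = (if s = f \<and> s \<in> S then {[]} else {})"
  by (auto simp: path_words_def)

lemma path_words_outside: "s \<notin> S \<Longrightarrow> path_words q t S s f k = {}"
  by (auto simp: path_words_def dest!: run_SomeD)

definition step_letters :: "nat \<Rightarrow> nat \<Rightarrow> state \<Rightarrow> state \<Rightarrow> nat set" where
  "step_letters q t s s' = {a \<in> {0..q + t}. step q t s a = Some s'}"

text \<open>These are the entries of M: rows (t, q, 1) for A and B, and (t, 0, 1) for C. The equal
  rows make M singular; the zero makes its block on B and C triangular.\<close>

lemma card_step_letters: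
  "card (step_letters q t s State_A) = t"
  "card (step_letters q t State_A State_B) = q"
  "card (step_letters q t State_B State_B) = q"
  "card (step_letters q t State_C State_B) = 0"
  "card (step_letters q t s State_C) = 1"
proof -
  have "step_letters q t s State_A = {1 + q..q + t}"
    by (auto simp: step_letters_def step_eq_State_A_iff)
  then show "card (step_letters q t s State_A) = t" by simp
  have "step_letters q t State_A State_B = {1..q}" "step_letters q t State_B State_B = {1..q}"
    "step_letters q t State_C State_B = {}"
    by (auto simp: step_letters_def step_def split: if_splits)
  then show "card (step_letters q t State_A State_B) = q"
    "card (step_letters q t State_B State_B) = q"
    "card (step_letters q t State_C State_B) = 0" by simp_all
  have "step_letters q t s State_C = (if s = State_C then {q} else {0})"
    by (cases s) (auto simp: step_letters_def step_def split: if_splits)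
  then show "card (step_letters q t s State_C) = 1" by simp
qed

lemma path_words_Suc:
  assumes "s \<in> S"
  shows "path_words q t S s f (Suc k) =
    (\<Union>s'. (\<lambda>(a, w). a # w) ` (step_letters q t s s' \<times> path_words q t S s' f k))"
    (is "?L = ?R")
proof (rule set_eqI)
  fix w
  show "w \<in> ?L \<longleftrightarrow> w \<in> ?R"
  proof
    assume "w \<in> ?L"
    then obtain a v p where w: "w = a # v" "a \<in> {0..q + t}" "v \<in> lists {0..q + t}" "length v = k"
      "run q t s (a # v) = Some p" "last p = f" "set p \<subseteq> S"
      by (cases w) (auto simp: path_words_def simp del: run.simps)
    then obtain s' p' where s': "step q t s a = Some s'" "run q t s' v = Some p'" "p = s # p'"
      by (auto split: option.splits)
    moreover have "p' \<noteq> []"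
      using run_SomeD[OF s'(2)] by auto
    ultimately have "a \<in> step_letters q t s s'" "v \<in> path_words q t S s' f k"
      using w by (auto simp: step_letters_def path_words_def)
    then show "w \<in> ?R"
      using w(1) by force
  next
    assume "w \<in> ?R"
    then obtain s' a v where w: "w = a # v" "a \<in> step_letters q t s s'" "v \<in> path_words q t S s' f k"
      by auto
    then obtain p where p: "run q t s' v = Some p" "last p = f" "set p \<subseteq> S"
      by (auto simp: path_words_def)
    moreover have "p \<noteq> []"
      using run_SomeD[OF p(1)] by auto
    ultimately show "w \<in> ?L"
      using w assms by (auto simp: path_words_def step_letters_def)
  qed
qed

text \<open>For s and f in \<open>S\<close>, this is the (s, f) entry of the k-th power of the
  transition matrix restricted to \<open>S\<close>; \<open>UNIV\<close> yields M, and the set of B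
  and C yields M'.\<close>

definition path_count :: "nat \<Rightarrow> nat \<Rightarrow> state set \<Rightarrow> state \<Rightarrow> state \<Rightarrow> nat \<Rightarrow> nat" where
  "path_count q t S s f k = card (path_words q t S s f k)"

lemma path_count_0: "path_count q t S s f 0 = (if s = f \<and> s \<in> S then 1 else 0)"
  by (auto simp: path_count_def path_words_0)

lemma path_count_outside: "s \<notin> S \<Longrightarrow> path_count q t S s f k = 0"
  by (simp add: path_count_def path_words_outside)

lemma path_count_Suc:
  assumes "s \<in> S"
  shows "path_count q t S s f (Suc k) =
    (\<Sum>s'\<in>{State_A, State_B, State_C}. card (step_letters q t s s') * path_count q t S s' f k)"
proof -
  have fin: "finite (step_letters q t s s')" for s'
    by (simp add: step_letters_def)
  have inj: "inj_on (\<lambda>(a, w). a # w) X" for X :: "(nat \<times> nat list) set"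
    by (auto simp: inj_on_def)
  have "path_count q t S s f (Suc k) =
      (\<Sum>s'\<in>UNIV. card ((\<lambda>(a, w). a # w) ` (step_letters q t s s' \<times> path_words q t S s' f k)))"
    unfolding path_count_def path_words_Suc[OF assms]
    \<comment> \<open>Disjointness is determinism: the first letter of a word fixes the next state
      s'.\<close>
    by (rule card_UN_disjoint) (auto simp: UNIV_state fin step_letters_def)
  then show ?thesis
    by (simp add: card_image[OF inj] card_cartesian_product path_count_def UNIV_state)
qed

definition closed_count :: "nat \<Rightarrow> nat \<Rightarrow> state set \<Rightarrow> nat \<Rightarrow> nat" where
  "closed_count q t S k = (\<Sum>s\<in>UNIV. path_count q t S s s k)"

lemma closed_count_avoiding_A:
  "closed_count q t {State_B, State_C} k = q ^ k + 1"
proof -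
  let ?n = "path_count q t {State_B, State_C}"
  \<comment> \<open>Avoiding A, there is no way back from C to B, so M' is triangular with diagonal
    q, 1. The induction for B needs the vanishing C-to-B count.\<close>
  have "?n State_C State_C k = 1 \<and> ?n State_C State_B k = 0 \<and> ?n State_B State_B k = q ^ k"
    by (induction k) (simp_all add: path_count_0 path_count_Suc path_count_outside card_step_letters[simplified])
  then show ?thesis
    by (simp add: closed_count_def UNIV_state path_count_outside)
qed

text \<open>The transition matrix is singular, so that its Cayley-Hamilton recurrence has order two
  from index 1 on.\<close>

lemma closed_count_UNIV:
  "closed_count q t UNIV 1 = 1 + q + t"
  "closed_count q t UNIV 2 + 2 * q = (1 + q + t) * closed_count q t UNIV 1"
  "closed_count q t UNIV (Suc (Suc (Suc k))) + q * closed_count q t UNIV (Suc k) =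
     (1 + q + t) * closed_count q t UNIV (Suc (Suc k))"
  by (simp_all add: closed_count_def UNIV_state path_count_0 path_count_Suc
      card_step_letters[simplified] numeral_2_eq_2 algebra_simps)

lemma word_count_lang:
  "word_count (lang q t) k + closed_count q t {State_B, State_C} k = closed_count q t UNIV k"
proof -
  define V where "V s = path_words q t UNIV s s k - path_words q t {State_B, State_C} s s k" for s
  have sub: "path_words q t {State_B, State_C} s s k \<subseteq> path_words q t UNIV s s k" for s
    by (auto simp: path_words_def)
  have A: "set p \<subseteq> {State_B, State_C} \<longleftrightarrow> State_A \<notin> set p" for p
    by (metis UNIV_I UNIV_state insertE state.distinct(1,3) subset_eq emptyE)
  \<comment> \<open>As the run of w from s is unique, deleting the words whose run avoids A leaves
    exactly those whose run meets A.\<close>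
  have V: "V s = {w \<in> lists {0..q + t}. length w = k \<and>
      (\<exists>p. run q t s w = Some p \<and> last p = s \<and> State_A \<in> set p)}" for s
    unfolding V_def path_words_def A by auto
  have "{w \<in> lang q t. length w = k} = (\<Union>s. V s)"
    by (auto simp: V lang_def)
  then have "word_count (lang q t) k = card (\<Union>s. V s)"
    by (simp add: word_count_def)
  also have "\<dots> = (\<Sum>s\<in>UNIV. card (V s))"
  proof (rule card_UN_disjoint)
    show "\<forall>s\<in>UNIV. \<forall>s'\<in>UNIV. s \<noteq> s' \<longrightarrow> V s \<inter> V s' = {}"
      using closed_run_unique[of q t] by (fastforce simp: V)
  qed (auto simp: UNIV_state V_def)
  finally have "word_count (lang q t) k + closed_count q t {State_B, State_C} k =
      (\<Sum>s\<in>UNIV. card (V s) + path_count q t {State_B, State_C} s s k)"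
    by (simp add: closed_count_def sum.distrib)
  also have "\<dots> = closed_count q t UNIV k"
    \<comment> \<open>The inclusion makes the subtraction of cardinalities in the natural numbers
      exact.\<close>
    using card_mono[OF _ sub]
    by (simp add: V_def closed_count_def path_count_def card_Diff_subset sub)
  finally show ?thesis .
qed

theorem theorem14:
  fixes q t :: nat
  assumes "t \<ge> 1"
  shows "zeta (lang q t) =
    ((1 - of_nat q * fps_X) * (1 - fps_X)) /
    (1 - (1 + of_nat q + of_nat (word_count (lang q t) 1)) * fps_X + of_nat q * fps_X ^ 2)"
proof -
  define W where "W = word_count (lang q t)"
  define F :: "rat fps" where "F = Abs_fps (\<lambda>k. if k = 0 then 0 else of_nat (W k) / of_nat k)"
  define c where "c = closed_count q t UNIV"
  \<comment> \<open>Indices are shifted by one because differentiating \<open>F\<close> cancels the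
    factor 1/k and lowers the exponent.\<close>
  define P :: "rat fps" where "P = Abs_fps (\<lambda>k. of_nat (c (Suc k)))"
  define Q :: "rat fps" where "Q = Abs_fps (\<lambda>k. of_nat q ^ Suc k)"
  define R :: "rat fps" where "R = Abs_fps (\<lambda>k. 1)"
  define u :: "rat fps" where "u = of_nat q"
  define v :: "rat fps" where "v = 1 + of_nat q + of_nat t"
  have u: "u = fps_const (of_nat q)" and v: "v = fps_const (1 + of_nat q + of_nat t)"
    by (simp_all add: u_def v_def flip: fps_of_nat fps_const_add)
  have W: "W k + (q ^ k + 1) = c k" for k
    using word_count_lang[of q t k] by (simp add: W_def c_def closed_count_avoiding_A)
  \<comment> \<open>This turns the denominator in the statement into det (1 - T M).\<close>
  have W1: "W 1 = t"
    using W[of 1] closed_count_UNIV(1)[of q t] by (simp add: c_def)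
  have F': "fps_deriv F = P - Q - R"
  proof (rule fps_ext)
    fix k
    have "(of_nat (c (Suc k)) :: rat) = of_nat (W (Suc k)) + of_nat q ^ Suc k + 1"
      by (simp flip: W)
    then show "fps_nth (fps_deriv F) k = fps_nth (P - Q - R) k"
      by (simp add: F_def P_def Q_def R_def)
  qed
  have Q: "Q * (1 - u * fps_X) = u"
    by (rule fps_ext) (auto simp: Q_def u algebra_simps fps_mult_fps_X_commute[symmetric] gr0_conv_Suc)
  have R: "R * (1 - fps_X) = 1"
    by (rule fps_ext) (auto simp: R_def algebra_simps)
  have c1: "(of_nat (c 1) :: rat) = 1 + of_nat q + of_nat t"
    using closed_count_UNIV(1)[of q t] by (simp add: c_def)
  have c2: "(of_nat (c 2) :: rat) = (1 + of_nat q + of_nat t) * of_nat (c 1) - 2 * of_nat q"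
    using arg_cong[OF closed_count_UNIV(2)[of q t], of "of_nat :: nat \<Rightarrow> rat"]
    by (simp add: c_def algebra_simps)
  have c3: "(of_nat (c (Suc (Suc (Suc k)))) :: rat) =
      (1 + of_nat q + of_nat t) * of_nat (c (Suc (Suc k))) - of_nat q * of_nat (c (Suc k))" for k
    using arg_cong[OF closed_count_UNIV(3)[of q t k], of "of_nat :: nat \<Rightarrow> rat"]
    by (simp add: c_def algebra_simps)
  \<comment> \<open>For D = 1 - v T + u T^2 this says P = -D'/D. Coefficients 0 and 1 use
    \<open>c1\<close> and \<open>c2\<close>, where Newton's identity p_2 = e_1 p_1 - 2 e_2 explains
    the factor 2; the others use the recurrence \<open>c3\<close>.\<close>
  have P: "P * (1 - v * fps_X + u * fps_X ^ 2) = v - 2 * u * fps_X"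
  proof (rule fps_ext)
    fix n
    have *: "P * (1 - v * fps_X + u * fps_X ^ 2) = P - v * (fps_X * P) + u * (fps_X * (fps_X * P))"
      by (simp add: algebra_simps power2_eq_square)
    have **: "v - 2 * u * fps_X = v - fps_const (2 * of_nat q) * fps_X"
      by (simp add: u numeral_fps_const)
    consider "n = 0" | "n = 1" | k where "n = Suc (Suc k)"
      by (metis One_nat_def not0_implies_Suc)
    then show "fps_nth (P * (1 - v * fps_X + u * fps_X ^ 2)) n = fps_nth (v - 2 * u * fps_X) n"
      unfolding * ** using c1 c2 c3
      by cases (simp_all add: P_def u v numeral_2_eq_2)
  qed
  have "fps_compose (fps_exp 1) F =
      ((1 - u * fps_X) * (1 - fps_X)) / (1 - v * fps_X + u * fps_X ^ 2)" (is "_ = ?N / ?D")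
  proof (rule fps_exp_compose_eq_divide)
    have const: "fps_deriv u = 0" "fps_deriv v = 0"
      by (simp_all add: u v)
    have N': "fps_deriv ?N = - u * (1 - fps_X) - (1 - u * fps_X)"
      by (simp add: const algebra_simps)
    have D': "fps_deriv ?D = 2 * u * fps_X - v"
      by (simp add: const power2_eq_square algebra_simps)
    \<comment> \<open>Each of \<open>P\<close>, \<open>Q\<close>, \<open>R\<close> is grouped with
      the factor that turns it into a polynomial.\<close>
    have "fps_deriv F * ?N * ?D = ?N * (P * ?D)
        - (Q * (1 - u * fps_X)) * (1 - fps_X) * ?D - (R * (1 - fps_X)) * (1 - u * fps_X) * ?D"
      by (simp add: F' algebra_simps)
    also have "\<dots> = fps_deriv ?N * ?D - fps_deriv ?D * ?N"
      unfolding P Q R N' D' by (simp add: algebra_simps)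
    finally show "fps_deriv F * ?N * ?D = fps_deriv ?N * ?D - fps_deriv ?D * ?N" .
  qed (simp_all add: F_def)
  then show ?thesis
    using W1 by (simp only: zeta_def F_def W_def u_def v_def)
qed

end
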